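(* Let $n\ge 2$ and let $a_1,\dots,a_n$ be positive integers with $\gcd(a_1,\dots,a_n)=1$. Let $d=\gcd(a_1,a_2,\dots,a_{n-1},a_n-1)$. Then the Frobenius number $F(a_1,\dots,a_n)$ is divisible by $d$.
   Context: For positive integers $a_1,\dots,a_n$ with $\gcd(a_1,\dots,a_n)=1$, let $S=S(a_1,\dots,a_n)=\{x_1a_1+\dots+x_na_n : x_i\in\mathbb{Z}_{\ge 0}\}$ be the numerical semigroup they generate. The Frobenius number is $F(a_1,\dots,a_n)=\min\{s\in S : \text{every integer } k\ge s \text{ lies in } S\}$ (so $F-1$ is the largest integer not in $S$, and $F=0$ if $S=\mathbb{Z}_{\ge 0}$). Here $\gcd(\dots,0)$ is understood in the usual way if $a_n=1$. *)

theory Defs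
  imports Main
begin

definition numerical_semigroup :: "nat \<Rightarrow> (nat \<Rightarrow> nat) \<Rightarrow> nat set" where
  "numerical_semigroup n a = {s. \<exists>x :: nat \<Rightarrow> nat. s = (\<Sum>i=1..n. x i * a i)}"

text \<open>
  The Frobenius number in this convention is one more than the largest integer outside the
  semigroup. The least element exists when the generators are coprime; all
  elements of the semigroup are nonnegative, so ranging over naturals loses nothing.
\<close>

definition frobenius_number :: "nat \<Rightarrow> (nat \<Rightarrow> nat) \<Rightarrow> nat" where
  "frobenius_number n a =
     (LEAST s. s \<in> numerical_semigroup n a \<and> (\<forall>k\<ge>s. k \<in> numerical_semigroup n a))"

end

(* Let a_n be the last generator and let d divide the other generators and a_n - 1. An element of the
   semigroup that is not divisible by d must use a_n, so subtracting a_n stays in the semigroup.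
   If d does not divide F, then it does not divide F - 1 + a_n, which is at least F and thus lies
   in the semigroup; hence so does F - 1, contradicting the minimality of F. *)
theory Submission imports Defs begin

lemma zero_in_numerical_semigroup: "0 \<in> numerical_semigroup n a"
  unfolding numerical_semigroup_def by (auto intro!: exI[of _ "\<lambda>_. 0"])

lemma add_in_numerical_semigroup:
  assumes "s \<in> numerical_semigroup n a" "t \<in> numerical_semigroup n a"
  shows "s + t \<in> numerical_semigroup n a"
proof -
  obtain x y where "s = (\<Sum>i=1..n. x i * a i)" "t = (\<Sum>i=1..n. y i * a i)"
    using assms unfolding numerical_semigroup_def by blast
  then have "s + t = (\<Sum>i=1..n. (x i + y i) * a i)"
    by (simp add: sum.distrib distrib_right)
  then show ?thesis
    unfolding numerical_semigroup_def by (intro CollectI exI[of _ "\<lambda>i. x i + y i"])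
qed

lemma mult_in_numerical_semigroup:
  assumes "s \<in> numerical_semigroup n a"
  shows "k * s \<in> numerical_semigroup n a"
  by (induction k)
    (simp_all add: zero_in_numerical_semigroup add_in_numerical_semigroup assms)

lemma generator_in_numerical_semigroup:
  assumes "j \<in> {1..n}"
  shows "a j \<in> numerical_semigroup n a"
proof -
  have "(\<Sum>i=1..n. (if i = j then 1 else 0) * a i) = (\<Sum>i=1..n. if i = j then a i else 0)"
    by (rule sum.cong) auto
  also have "\<dots> = a j"
    using assms by simp
  finally show ?thesis
    unfolding numerical_semigroup_def
    by (intro CollectI exI[of _ "\<lambda>i. if i = j then 1 else 0"]) simp
qed

text \<open>Bezout coefficients may be negative, so the gcd itself need not lie in the semigroup; it
  is realized as a difference of two elements instead, adding one generator at a time. For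
  \<open>k = n\<close> and gcd 1 this yields two consecutive elements.\<close>

lemma numerical_semigroup_difference_Gcd:
  assumes "\<And>i. i \<in> {1..n} \<Longrightarrow> a i > 0" "k \<le> n"
  shows "\<exists>t \<in> numerical_semigroup n a. t + Gcd (a ` {1..k}) \<in> numerical_semigroup n a"
  using assms(2)
proof (induction k)
  case 0
  show ?case
    using zero_in_numerical_semigroup by (intro bexI[of _ 0]) simp_all
next
  case (Suc k)
  let ?S = "numerical_semigroup n a" and ?G = "Gcd (a ` {1..k})" and ?b = "a (Suc k)"
  obtain t where t: "t \<in> ?S" "t + ?G \<in> ?S"
    using Suc by auto
  have "?b \<noteq> 0" "?b \<in> ?S"
    using assms(1)[of "Suc k"] generator_in_numerical_semigroup[of "Suc k"] Suc.prems by auto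
  \<comment> \<open>This subtraction-free Bezout identity needs only \<open>?b\<close> nonzero, so
    it also covers the start, where \<open>?G\<close> is the gcd of the empty set, 0.\<close>
  obtain x y where xy: "?b * x = ?G * y + gcd ?b ?G"
    using bezout_nat[OF \<open>?b \<noteq> 0\<close>] by blast
  have "Gcd (a ` {1..Suc k}) = gcd ?b ?G"
    by (simp add: atLeastAtMostSuc_conv)
  \<comment> \<open>Adding \<open>y * t\<close> to both sides of the Bezout identity turns
    \<open>y * ?G\<close>, which may lie outside the semigroup, into a multiple of
    \<open>t + ?G\<close>.\<close>
  then have "y * (t + ?G) + Gcd (a ` {1..Suc k}) = x * ?b + y * t"
    using xy by (simp add: algebra_simps)
  then show ?case
    using t \<open>?b \<in> ?S\<close>
    by (intro bexI[of _ "y * (t + ?G)"])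
      (simp_all only: add_in_numerical_semigroup mult_in_numerical_semigroup)
qed

text \<open>Consecutive elements \<open>m\<close> and \<open>m + 1\<close> generate every
  \<open>k \<ge> m * m\<close>: write k = q m + r with r < m \<le> q, so that k = (q - r) m + r (m +
  1).\<close>

lemma numerical_semigroup_cofinite:
  assumes "\<And>i. i \<in> {1..n} \<Longrightarrow> a i > 0" "Gcd (a ` {1..n}) = 1"
  shows "\<exists>s. \<forall>k\<ge>s. k \<in> numerical_semigroup n a"
proof -
  let ?S = "numerical_semigroup n a"
  obtain m where m: "m \<in> ?S" "m + 1 \<in> ?S"
    using numerical_semigroup_difference_Gcd[of n a n] assms by auto
  have "k \<in> ?S" if "k \<ge> m * m" for k
  \<comment> \<open>Division by 0 gives no small remainder, but here \<open>m + 1\<close> is 1,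
    which generates everything.\<close>
  proof (cases "m = 0")
    case True
    then show ?thesis
      using mult_in_numerical_semigroup[OF m(2), of k] by simp
  next
    case False
    then have "k mod m \<le> k div m"
      using that div_le_mono[of "m * m" k m]
      by (simp add: less_imp_le[OF less_le_trans[OF mod_less_divisor]])
    then obtain c where c: "k div m = k mod m + c"
      using le_Suc_ex by blast
    have "k = (k div m) * m + k mod m"
      by simp
    also have "\<dots> = c * m + (k mod m) * (m + 1)"
      unfolding c by (simp add: algebra_simps)
    finally show ?thesis
      by (metis add_in_numerical_semigroup mult_in_numerical_semigroup m)
  qed
  then show ?thesis by blast
qed

text \<open>The terms before the last sum to a multiple of \<open>d\<close>, so the coefficient of
  \<open>a n\<close> cannot vanish and can be lowered by one.\<close>

lemma numerical_semigroup_diff_last: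
  assumes "s \<in> numerical_semigroup n a" "\<And>i. i \<in> {1..<n} \<Longrightarrow> d dvd a i" "\<not> d dvd s" "n \<ge> 1"
  shows "\<exists>t \<in> numerical_semigroup n a. s = t + a n"
proof -
  obtain x where x: "s = (\<Sum>i=1..n. x i * a i)"
    using assms(1) unfolding numerical_semigroup_def by blast
  have split: "(\<Sum>i=1..n. f i) = (\<Sum>i=1..<n. f i) + f n" for f :: "nat \<Rightarrow> nat"
    using \<open>n \<ge> 1\<close> by (simp add: sum.last_plus add.commute)
  have "d dvd (\<Sum>i=1..<n. x i * a i)"
    using assms(2) by (intro dvd_sum) simp
  then have "x n \<noteq> 0"
    using assms(3) x split[of "\<lambda>i. x i * a i"] by (intro notI) simp
  let ?y = "x(n := x n - 1)"
  have "(\<Sum>i=1..<n. ?y i * a i) = (\<Sum>i=1..<n. x i * a i)"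
    by (rule sum.cong) auto
  then have "s = (\<Sum>i=1..n. ?y i * a i) + a n"
    using \<open>x n \<noteq> 0\<close> x split[of "\<lambda>i. x i * a i"] split[of "\<lambda>i. ?y i * a i"]
    by (cases "x n") auto
  then show ?thesis
    unfolding numerical_semigroup_def by blast
qed

theorem theorem1:
  fixes n :: nat and a :: "nat \<Rightarrow> nat" and d :: nat
  assumes "n \<ge> 2"
    and "\<And>i. i \<in> {1..n} \<Longrightarrow> a i > 0"
    and "Gcd (a ` {1..n}) = 1"
    and "d = gcd (Gcd (a ` {1..n-1})) (a n - 1)"
  shows "d dvd frobenius_number n a"
proof (rule ccontr)
  assume ndvd: "\<not> d dvd frobenius_number n a"
  let ?S = "numerical_semigroup n a" and ?F = "frobenius_number n a"
  let ?P = "\<lambda>s. s \<in> ?S \<and> (\<forall>k\<ge>s. k \<in> ?S)"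
  have F: "?F = (LEAST s. ?P s)"
    unfolding frobenius_number_def ..
  \<comment> \<open>Existence is what makes the \<open>LEAST\<close> satisfy its own
    predicate.\<close>
  have "\<exists>s. ?P s"
    using numerical_semigroup_cofinite[OF assms(2,3)] by blast
  then have PF: "?P ?F"
    unfolding F by (rule LeastI_ex)
  have "?F > 0"
    using ndvd by (intro gr0I) simp
  have "a n > 0"
    using assms(1,2) by simp
  have dvd_gen: "d dvd a i" if "i \<in> {1..<n}" for i
  proof -
    have "Gcd (a ` {1..n-1}) dvd a i"
      using that by (intro Gcd_dvd) auto
    then show ?thesis
      unfolding assms(4) by (rule dvd_trans[OF gcd_dvd1])
  qed
  \<comment> \<open>With truncated subtraction, moving the 1 across requires both numbers to be
    positive. The right-hand side shows at once that the number is at least \<open>?F\<close> and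
    congruent to \<open>?F\<close> modulo \<open>d\<close>.\<close>
  have eq: "?F - 1 + a n = ?F + (a n - 1)"
    using \<open>?F > 0\<close> \<open>a n > 0\<close> by simp
  have "d dvd a n - 1"
    unfolding assms(4) by simp
  then have "\<not> d dvd ?F - 1 + a n"
    unfolding eq using ndvd by (simp add: dvd_add_left_iff)
  moreover have "?F - 1 + a n \<in> ?S"
    unfolding eq using PF by simp
  ultimately have "?F - 1 \<in> ?S"
    using numerical_semigroup_diff_last[of "?F - 1 + a n" n a d] dvd_gen assms(1) by auto
  have "?P (?F - 1)"
  proof (intro conjI allI impI)
    fix k assume "k \<ge> ?F - 1"
    then have "k = ?F - 1 \<or> k \<ge> ?F" by linarith
    then show "k \<in> ?S"
      using PF \<open>?F - 1 \<in> ?S\<close> by blast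
  qed fact
  then have "?F \<le> ?F - 1"
    using Least_le[of ?P "?F - 1"] unfolding F by blast
  then show False
    using \<open>?F > 0\<close> by simp
qed

end
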